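(* Let $0\le\alpha<1$ and let $f(z)=zh(z)\overline{g(z)}\in ST_{Lh}(\alpha)$ be logharmonic with respect to $a\in B$. Let $$K(z)=z\exp\left(2\operatorname{Re}\int_0^z\frac{a(s)}{1-a(s)}\,\frac{ds}{s}\right).$$ Then $$F(z)=f(z)^{\frac{1}{1-\alpha}}\,K(z)^{\frac{-\alpha}{1-\alpha}}\in ST_{Lh}(0).$$
   Context: Let $U=\{z\in\mathbb{C}:|z|<1\}$, let $H(U)$ be the space of analytic functions on $U$, and let $B$ be the set of $a\in H(U)$ with $|a(z)|<1$ in $U$. A logharmonic mapping on $U$ with respect to $a\in B$ is a solution $f$ of $$\frac{\overline{f_{\overline z}}}{\overline f}=a\,\frac{f_z}{f}.$$ For $0\le\alpha<1$, $ST_{Lh}(\alpha)$ (starlike logharmonic mappings of order $\alpha$) is the set of all univalent logharmonic mappings on $U$ (with respect to some $a\in B$) of the form $f(z)=zh(z)\overline{g(z)}$, where $h,g\in H(U)$ are nonvanishing, $g(0)=1$, such that $$\operatorname{Re}\frac{zf_z-\overline z f_{\overline z}}{f}>\alpha\quad\text{for all } z\in U .$$ The form $f=zh\overline g$ forces $a(0)=0$, so the integral defining $K$ makes sense. Writing $K(z)=z\,k(z)\overline{k(z)}$ with $k(z)=\exp\int_0^z\frac{a(s)}{(1-a(s))s}ds$, the powers are understood through analytic branches of powers of the nonvanishing functions $h,g,k$, i.e. $F(z)=z\,\bigl(h(z)^{\frac1{1-\alpha}}k(z)^{\frac{-\alpha}{1-\alpha}}\bigr)\overline{\bigl(g(z)^{\frac1{1-\alpha}}k(z)^{\frac{-\alpha}{1-\alpha}}\bigr)}$,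 with the branches of powers of $g$ and $k$ equal to $1$ at $0$. *)

theory Defs
  imports "HOL-Complex_Analysis.Complex_Analysis"
begin

definition unit_disk :: "complex set" where
  "unit_disk = ball 0 1"

text \<open>
  The Wirtinger derivatives
  \<open>f\<^sub>z = (f\<^sub>x - \<i> f\<^sub>y) / 2\<close> and \<open>f\<^sub>z\<^sub>b\<^sub>a\<^sub>r = (f\<^sub>x + \<i> f\<^sub>y) / 2\<close>, expressed through the real
  Frechet derivative.  They are meaningful only where \<open>f\<close> is real-differentiable.
\<close>

definition wirtinger_z :: "(complex \<Rightarrow> complex) \<Rightarrow> complex \<Rightarrow> complex" where
  "wirtinger_z f z =
     (frechet_derivative f (at z) 1 - \<i> * frechet_derivative f (at z) \<i>) / 2"

definition wirtinger_zbar :: "(complex \<Rightarrow> complex) \<Rightarrow> complex \<Rightarrow> complex" where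
  "wirtinger_zbar f z =
     (frechet_derivative f (at z) 1 + \<i> * frechet_derivative f (at z) \<i>) / 2"

definition dilatations :: "(complex \<Rightarrow> complex) set" where
  "dilatations = {a. a holomorphic_on unit_disk \<and> (\<forall>z\<in>unit_disk. norm (a z) < 1)}"

text \<open>
  Classical solutions.  The equation involves division by \<open>f\<close>, so it is imposed off the
  zeros of \<open>f\<close>.
\<close>

definition logharmonic_wrt :: "(complex \<Rightarrow> complex) \<Rightarrow> (complex \<Rightarrow> complex) \<Rightarrow> bool" where
  "logharmonic_wrt a f \<longleftrightarrow>
     f differentiable_on unit_disk \<and>
     (\<forall>z\<in>unit_disk. f z \<noteq> 0 \<longrightarrow>
        cnj (wirtinger_zbar f z) / cnj (f z) = a z * (wirtinger_z f z / f z))"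

definition logharmonic_factors ::
    "(complex \<Rightarrow> complex) \<Rightarrow> (complex \<Rightarrow> complex) \<Rightarrow> (complex \<Rightarrow> complex) \<Rightarrow> bool" where
  "logharmonic_factors f h g \<longleftrightarrow>
     h holomorphic_on unit_disk \<and> (\<forall>z\<in>unit_disk. h z \<noteq> 0) \<and>
     g holomorphic_on unit_disk \<and> (\<forall>z\<in>unit_disk. g z \<noteq> 0) \<and> g 0 = 1 \<and>
     (\<forall>z\<in>unit_disk. f z = z * h z * cnj (g z))"

text \<open>
  Starlike logharmonic mappings of order \<open>\<alpha>\<close>.  At the origin the quotient is \<open>0 / 0\<close>, with
  continuous extension \<open>1\<close>; since \<open>x / 0 = 0\<close> in HOL, the origin has to be excluded (the
  inequality for the extended quotient holds there for every \<open>\<alpha> < 1\<close>).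
\<close>

definition ST_Lh :: "real \<Rightarrow> (complex \<Rightarrow> complex) set" where
  "ST_Lh \<alpha> = {f.
     inj_on f unit_disk \<and>
     (\<exists>a\<in>dilatations. logharmonic_wrt a f) \<and>
     (\<exists>h g. logharmonic_factors f h g) \<and>
     (\<forall>z\<in>unit_disk - {0}.
        Re ((z * wirtinger_z f z - cnj z * wirtinger_zbar f z) / f z) > \<alpha>)}"

text \<open>
  The integrand has a removable singularity at \<open>0\<close> when \<open>a 0 = 0\<close>; its (junk) value at that
  single point does not affect the integral.
\<close>

definition lh_integral :: "(complex \<Rightarrow> complex) \<Rightarrow> complex \<Rightarrow> complex" where
  "lh_integral a z = contour_integral (linepath 0 z) (\<lambda>s. a s / (1 - a s) * (1 / s))"

definition lh_k :: "(complex \<Rightarrow> complex) \<Rightarrow> complex \<Rightarrow> complex" where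
  "lh_k a z = exp (lh_integral a z)"

definition lh_K :: "(complex \<Rightarrow> complex) \<Rightarrow> complex \<Rightarrow> complex" where
  "lh_K a z = z * exp (of_real (2 * Re (lh_integral a z)))"

lemma lh_K_eq: "lh_K a z = z * lh_k a z * cnj (lh_k a z)"
proof -
  have "exp (of_real (2 * Re (lh_integral a z))) = lh_k a z * cnj (lh_k a z)"
    unfolding lh_k_def exp_cnj exp_add [symmetric] by (simp only: complex_add_cnj)
  then show ?thesis
    by (simp add: lh_K_def mult.assoc)
qed

text \<open>
  \<open>p\<close> is an analytic branch of \<open>\<phi>\<close> to the power \<open>c\<close>: it is \<open>exp (c * L)\<close> for some analytic
  logarithm \<open>L\<close> of \<open>\<phi>\<close>.
\<close>

definition power_branch ::
    "real \<Rightarrow> (complex \<Rightarrow> complex) \<Rightarrow> (complex \<Rightarrow> complex) \<Rightarrow> bool" where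
  "power_branch c \<phi> p \<longleftrightarrow>
     (\<exists>L. L holomorphic_on unit_disk \<and>
          (\<forall>z\<in>unit_disk. exp (L z) = \<phi> z \<and> p z = exp (of_real c * L z)))"

text \<open>
  \<open>F\<close> is \<open>f\<close> to the power \<open>1 / (1 - \<alpha>)\<close> times \<open>lh_K a\<close> to the power \<open>-\<alpha> / (1 - \<alpha>)\<close>, where
  \<open>f = z * h * cnj g\<close> and \<open>lh_K a = z * lh_k a * cnj (lh_k a)\<close>.  The exponents add up to \<open>1\<close>,
  so the powers of \<open>z\<close> combine to the single factor \<open>z\<close>; the remaining powers are analytic
  branches, normalized at \<open>0\<close> for \<open>g\<close> and \<open>lh_k a\<close> (this fixes them) and arbitrary for \<open>h\<close>.
\<close>

definition lh_power_product ::
    "real \<Rightarrow> (complex \<Rightarrow> complex) \<Rightarrow> (complex \<Rightarrow> complex) \<Rightarrow> (complex \<Rightarrow> complex) \<Rightarrow>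
     (complex \<Rightarrow> complex) \<Rightarrow> bool" where
  "lh_power_product \<alpha> a h g F \<longleftrightarrow>
     (\<exists>hp gp kp.
        power_branch (1 / (1 - \<alpha>)) h hp \<and>
        power_branch (1 / (1 - \<alpha>)) g gp \<and> gp 0 = 1 \<and>
        power_branch (- \<alpha> / (1 - \<alpha>)) (lh_k a) kp \<and> kp 0 = 1 \<and>
        (\<forall>z\<in>unit_disk. F z = z * (hp z * kp z) * cnj (gp z * kp z)))"

end

theory Submission
  imports Defs
begin

text \<open>
  Write \<open>F = z H cnj(G)\<close>.  Taking logarithmic derivatives, the equation for \<open>f\<close> and the identity
  \<open>z k' / k = a / (1 - a)\<close> give \<open>z G' / G = a (1 + z H' / H)\<close>, and
  \<open>1 + z H' / H - z G' / G = 1 + (z h' / h - z g' / g) / (1 - \<alpha>)\<close> has positive real part.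

  Univalence of \<open>F\<close> is seen in the coordinate \<open>\<zeta> = log z\<close> on the left half-plane, where
  \<open>\<Phi> = log (z H / G)\<close> satisfies \<open>Re \<Phi>' > 0\<close>, hence is injective (Noshiro--Warschawski), and
  commutes with translation by \<open>2 \<pi> \<i>\<close>.  Therefore each level set of \<open>Im \<Phi>\<close> is the graph of a
  continuous function of \<open>Re \<zeta>\<close>, and \<open>\<Phi>\<close> maps it onto a horizontal interval.  In the coordinate
  \<open>\<Phi>\<close>, the function \<open>log F = \<Phi> + 2 Re (log G)\<close> preserves horizontal lines, and along them
  its real part has derivative \<open>1 + 2 Re (a / (1 - a)) > 0\<close>.
\<close>

lemma open_unit_disk: "open unit_disk"
  and convex_unit_disk: "convex unit_disk"
  and zero_in_unit_disk: "0 \<in> unit_disk"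
  by (auto simp: unit_disk_def)

section \<open>Half-plane maps whose derivative has positive real part\<close>

text \<open>The difference quotient is the mean of \<open>f'\<close> over the segment from
  \<open>a\<close> to \<open>b\<close>, and a mean of numbers in the right half-plane stays there;
  \<open>u\<close> expresses this through real monotonicity. The sign gives injectivity and, on
  vertical segments, monotonicity of \<open>Im f\<close>.\<close>

lemma Re_difference_quotient_pos:
  fixes f :: "complex \<Rightarrow> complex"
  assumes S: "convex S" and ab: "a \<in> S" "b \<in> S" "a \<noteq> b"
    and der: "\<And>z. z \<in> S \<Longrightarrow> (f has_field_derivative f' z) (at z)"
    and pos: "\<And>z. z \<in> S \<Longrightarrow> Re (f' z) > 0"
  shows "Re ((f b - f a) / (b - a)) > 0"
proof -
  define u where "u t = Re (f (a + of_real t * (b - a)) / (b - a))" for t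
  have "u 0 < u 1"
  proof (rule DERIV_pos_imp_increasing[where f = u])
    fix t :: real assume t: "0 \<le> t" "t \<le> 1"
    define z where "z = a + of_real t * (b - a)"
    have "z = (1 - t) *\<^sub>R a + t *\<^sub>R b"
      by (simp add: z_def scaleR_conv_of_real algebra_simps)
    then have z: "z \<in> S"
      using S ab t by (simp add: convexD)
    have "((\<lambda>t. a + of_real t * (b - a)) has_vector_derivative (b - a)) (at t)"
      by (auto intro!: derivative_eq_intros)
    from field_vector_diff_chain_at[OF this, of f "f' z"]
    have "((\<lambda>t. f (a + of_real t * (b - a))) has_vector_derivative (b - a) * f' z) (at t)"
      using der[OF z] by (simp add: z_def o_def)
    then have "((\<lambda>t. f (a + of_real t * (b - a)) / (b - a))
        has_vector_derivative (b - a) * f' z / (b - a)) (at t)"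
      by (rule bounded_linear.has_vector_derivative[OF bounded_linear_divide])
    then have "((\<lambda>t. Re (f (a + of_real t * (b - a)) / (b - a)))
        has_vector_derivative Re ((b - a) * f' z / (b - a))) (at t)"
      by (rule bounded_linear.has_vector_derivative[OF bounded_linear_Re])
    then have "(u has_real_derivative Re (f' z)) (at t)"
      using ab unfolding u_def has_real_derivative_iff_has_vector_derivative by simp
    then show "\<exists>y. (u has_real_derivative y) (at t) \<and> y > 0"
      using pos[OF z] by blast
  qed simp
  then show ?thesis
    by (simp add: u_def diff_divide_distrib)
qed

text \<open>An implicit function argument by order alone: since \<open>v x\<close> is increasing,
  \<open>y < \<eta> x\<close> means \<open>v x y < c\<close>, and for fixed \<open>y\<close> this is
  an open condition on \<open>x\<close>; likewise for \<open>\<eta> x < y\<close>.\<close>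

lemma continuous_on_level_graph:
  fixes v :: "real \<Rightarrow> real \<Rightarrow> real"
  assumes T: "open T"
    and mono: "\<And>x. x \<in> T \<Longrightarrow> strict_mono (v x)"
    and cont: "\<And>y. continuous_on T (\<lambda>x. v x y)"
    and level: "\<And>x. x \<in> T \<Longrightarrow> v x (\<eta> x) = c"
  shows "continuous_on T \<eta>"
  unfolding continuous_on_eq_continuous_at[OF T]
proof
  fix x assume x: "x \<in> T"
  have *: "eventually (\<lambda>x. x \<in> T) (at x)"
    using T x by (auto simp: eventually_at_topological)
  have tend: "((\<lambda>x. v x y) \<longlongrightarrow> v x y) (at x)" for y
    using cont[of y] T x by (simp add: continuous_on_eq_continuous_at isCont_def)
  have "(\<eta> \<longlongrightarrow> \<eta> x) (at x)"
  proof (rule order_tendstoI)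
    fix y assume "y < \<eta> x"
    then have "v x y < c"
      using mono[OF x] level[OF x] by (auto simp: strict_mono_def)
    from order_tendstoD(2)[OF tend this] *
    show "eventually (\<lambda>x. y < \<eta> x) (at x)"
    proof eventually_elim
      case (elim w)
      then show ?case
        using level[of w] strict_mono_less[OF mono, of w y "\<eta> w"] by simp
    qed
  next
    fix y assume "\<eta> x < y"
    then have "c < v x y"
      using mono[OF x] level[OF x] by (auto simp: strict_mono_def)
    from order_tendstoD(1)[OF tend this] *
    show "eventually (\<lambda>x. \<eta> x < y) (at x)"
    proof eventually_elim
      case (elim w)
      then show ?case
        using level[of w] strict_mono_less[OF mono, of w "\<eta> w" y] by simp
    qed
  qed
  then show "isCont \<eta> x"
    by (simp add: isCont_def)
qed

text \<open>A level set of \<open>Im \<Phi>\<close> is a graph over all \<open>x < 0\<close>: on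
  each vertical line \<open>Im \<Phi>\<close> is increasing and, by periodicity, takes every real
  value. The graph is connected, so \<open>Re \<Phi>\<close> attains on it all values between two
  given ones.\<close>

lemma image_halfplane_horizontally_convex:
  fixes \<Phi> :: "complex \<Rightarrow> complex"
  assumes der: "\<And>\<zeta>. Re \<zeta> < 0 \<Longrightarrow> (\<Phi> has_field_derivative \<Phi>' \<zeta>) (at \<zeta>)"
    and pos: "\<And>\<zeta>. Re \<zeta> < 0 \<Longrightarrow> Re (\<Phi>' \<zeta>) > 0"
    and per: "\<And>\<zeta> n. Re \<zeta> < 0 \<Longrightarrow>
      \<Phi> (\<zeta> + of_int n * (2 * pi * \<i>)) = \<Phi> \<zeta> + of_int n * (2 * pi * \<i>)"
    and pts: "Re \<zeta>\<^sub>1 < 0" "Re \<zeta>\<^sub>2 < 0" "Im (\<Phi> \<zeta>\<^sub>1) = Im (\<Phi> \<zeta>\<^sub>2)"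
    and u: "Re (\<Phi> \<zeta>\<^sub>1) \<le> u" "u \<le> Re (\<Phi> \<zeta>\<^sub>2)"
  shows "\<exists>\<zeta>. Re \<zeta> < 0 \<and> \<Phi> \<zeta> = Complex u (Im (\<Phi> \<zeta>\<^sub>1))"
proof -
  define c where "c = Im (\<Phi> \<zeta>\<^sub>1)"
  define v where "v x y = Im (\<Phi> (Complex x y))" for x y
  have cont: "continuous_on {\<zeta>. Re \<zeta> < 0} \<Phi>"
    using der by (intro continuous_at_imp_continuous_on) (auto intro: DERIV_isCont)
  have mono: "strict_mono (v x)" if "x < 0" for x
  proof (rule strict_monoI)
    fix y y' :: real assume "y < y'"
    have "Re ((\<Phi> (Complex x y') - \<Phi> (Complex x y)) / (Complex x y' - Complex x y)) > 0"
      using that \<open>y < y'\<close> der pos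
      by (intro Re_difference_quotient_pos[where S = "{\<zeta>. Re \<zeta> < 0}"])
         (auto simp: convex_halfspace_Re_lt)
    \<comment> \<open>The displacement is \<i> times a positive real number, so the real part of the
      quotient is the increment of \<open>Im \<Phi>\<close> divided by
      \<open>y' - y\<close>.\<close>
    also have "Complex x y' - Complex x y = of_real (y' - y) * \<i>"
      by (simp add: complex_eq_iff)
    also have "(\<Phi> (Complex x y') - \<Phi> (Complex x y)) / (of_real (y' - y) * \<i>) =
        (\<Phi> (Complex x y') - \<Phi> (Complex x y)) / \<i> / of_real (y' - y)"
      by (simp only: divide_divide_eq_left mult.commute)
    also have "Re \<dots> = (v x y' - v x y) / (y' - y)"
      unfolding v_def Re_divide_of_real by simp
    finally show "v x y < v x y'"
      using \<open>y < y'\<close> by (simp add: zero_less_divide_iff)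
  qed
  have "\<exists>y. v x y = c" if x: "x < 0" for x
  proof -
    have shift: "v x (of_int n * (2 * pi)) = v x 0 + of_int n * (2 * pi)" for n
    proof -
      have "Complex x (of_int n * (2 * pi)) = Complex x 0 + of_int n * (2 * pi * \<i>)"
        by (simp add: complex_eq_iff)
      then show ?thesis
        using per[of "Complex x 0" n] x by (simp add: v_def)
    qed
    \<comment> \<open>Each period in height adds exactly \<open>2 * pi\<close> to
      \<open>v x\<close>, so \<open>m\<close> periods up and down from height 0 suffice to enclose
      \<open>c\<close>.\<close>
    define m where "m = \<lceil>\<bar>c - v x 0\<bar> / (2 * pi)\<rceil>"
    have "\<bar>c - v x 0\<bar> / (2 * pi) \<le> of_int m"
      unfolding m_def by (rule le_of_int_ceiling)
    then have m: "\<bar>c - v x 0\<bar> \<le> of_int m * (2 * pi)"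
      by (simp add: pos_divide_le_eq)
    then have "0 \<le> of_int m * (2 * pi)"
      by linarith
    moreover have "continuous_on {of_int (- m) * (2 * pi)..of_int m * (2 * pi)} (v x)"
      unfolding v_def Complex_eq
      by (intro continuous_intros continuous_on_compose2[OF cont]) (use x in auto)
    ultimately show ?thesis
      using IVT'[of "v x" "of_int (- m) * (2 * pi)" c "of_int m * (2 * pi)"] m
      unfolding shift by force
  qed
  then obtain \<eta> where \<eta>: "\<And>x. x < 0 \<Longrightarrow> v x (\<eta> x) = c"
    by metis
  have cont_v: "continuous_on {..<0} (\<lambda>x. v x y)" for y
    unfolding v_def Complex_eq
    by (intro continuous_intros continuous_on_compose2[OF cont]) auto
  have cont_\<eta>: "continuous_on {..<0} \<eta>"
    by (rule continuous_on_level_graph[where v = v and c = c, OF open_lessThan]) (use cont_v mono \<eta> in auto)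
  define \<gamma> where "\<gamma> x = Complex x (\<eta> x)" for x
  have "continuous_on {..<0} (\<lambda>x. Re (\<Phi> (\<gamma> x)))"
    unfolding \<gamma>_def Complex_eq
    by (intro continuous_intros continuous_on_compose2[OF cont] cont_\<eta>) auto
  then have conn: "connected ((\<lambda>x. Re (\<Phi> (\<gamma> x))) ` {..<0})"
    by (rule connected_continuous_image) simp
  \<comment> \<open>Strict monotonicity on vertical lines leaves no other points on the level, so
    \<open>\<zeta>\<^sub>1\<close> and \<open>\<zeta>\<^sub>2\<close> both lie on the graph.\<close>
  have on_graph: "\<zeta> = \<gamma> (Re \<zeta>)" if "Re \<zeta> < 0" "Im (\<Phi> \<zeta>) = c" for \<zeta>
    using strict_mono_eq[OF mono[OF that(1)], of "Im \<zeta>" "\<eta> (Re \<zeta>)"] \<eta>[OF that(1)] that(2)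
    by (simp add: v_def \<gamma>_def complex_eq_iff)
  have mem: "Re (\<Phi> \<zeta>) \<in> (\<lambda>x. Re (\<Phi> (\<gamma> x))) ` {..<0}" if "Re \<zeta> < 0" "Im (\<Phi> \<zeta>) = c" for \<zeta>
    using on_graph[OF that] that by (intro image_eqI[of _ _ "Re \<zeta>"]) auto
  have "u \<in> (\<lambda>x. Re (\<Phi> (\<gamma> x))) ` {..<0}"
    by (rule connectedD_interval[OF conn mem[of \<zeta>\<^sub>1] mem[of \<zeta>\<^sub>2]]) (use pts u in \<open>simp_all add: c_def\<close>)
  then obtain x where "x < 0" "u = Re (\<Phi> (\<gamma> x))"
    by auto
  then show ?thesis
    using \<eta>[of x] by (intro exI[of _ "\<gamma> x"]) (auto simp: \<gamma>_def v_def c_def complex_eq_iff)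
qed

text \<open>The added term is real, so points with equal values lie on one level of
  \<open>Im \<Phi>\<close>. With \<open>\<Phi>\<close> as coordinate, \<open>M\<close> has
  derivative \<open>M' / \<Phi>'\<close>; by \<open>posM\<close> the map is therefore strictly
  increasing along the level.\<close>

lemma inj_on_halfplane_plus_Re:
  fixes \<Phi> M :: "complex \<Rightarrow> complex"
  assumes der: "\<And>\<zeta>. Re \<zeta> < 0 \<Longrightarrow> (\<Phi> has_field_derivative \<Phi>' \<zeta>) (at \<zeta>)"
    and pos: "\<And>\<zeta>. Re \<zeta> < 0 \<Longrightarrow> Re (\<Phi>' \<zeta>) > 0"
    and per: "\<And>\<zeta> n. Re \<zeta> < 0 \<Longrightarrow>
      \<Phi> (\<zeta> + of_int n * (2 * pi * \<i>)) = \<Phi> \<zeta> + of_int n * (2 * pi * \<i>)"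
    and derM: "\<And>\<zeta>. Re \<zeta> < 0 \<Longrightarrow> (M has_field_derivative M' \<zeta>) (at \<zeta>)"
    and posM: "\<And>\<zeta>. Re \<zeta> < 0 \<Longrightarrow> 1 + 2 * Re (M' \<zeta> / \<Phi>' \<zeta>) > 0"
  shows "inj_on (\<lambda>\<zeta>. \<Phi> \<zeta> + of_real (2 * Re (M \<zeta>))) {\<zeta>. Re \<zeta> < 0}"
proof -
  define S where "S = {\<zeta>. Re \<zeta> < 0}"
  have S: "open S" "convex S"
    by (auto simp: S_def open_halfspace_Re_lt convex_halfspace_Re_lt)
  have inj: "inj_on \<Phi> S"
  proof (rule inj_onI, rule ccontr)
    fix a b assume "a \<in> S" "b \<in> S" "\<Phi> a = \<Phi> b" "a \<noteq> b"
    then show False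
      using Re_difference_quotient_pos[OF S(2), of a b \<Phi> \<Phi>'] der pos by (auto simp: S_def)
  qed
  have hol: "\<Phi> holomorphic_on S"
    unfolding holomorphic_on_open[OF S(1)] using der by (auto simp: S_def)
  obtain G where G: "G holomorphic_on \<Phi> ` S"
    "\<And>z. z \<in> S \<Longrightarrow> deriv \<Phi> z * deriv G (\<Phi> z) = 1" "\<And>z. z \<in> S \<Longrightarrow> G (\<Phi> z) = z"
    using holomorphic_has_inverse[OF hol S(1) inj] by metis
  have "open (\<Phi> ` S)"
    by (rule open_mapping_thm3[OF hol S(1) inj])
  have derG: "(G has_field_derivative inverse (\<Phi>' \<zeta>)) (at (\<Phi> \<zeta>))" if "\<zeta> \<in> S" for \<zeta>
  proof -
    have "deriv \<Phi> \<zeta> = \<Phi>' \<zeta>"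
      using der that by (intro DERIV_imp_deriv) (simp add: S_def)
    with G(2)[OF that] have "deriv G (\<Phi> \<zeta>) = inverse (\<Phi>' \<zeta>)"
      by (metis inverse_unique)
    then show ?thesis
      using holomorphic_derivI[OF G(1) \<open>open (\<Phi> ` S)\<close>] that by fastforce
  qed
  have less: "Re (\<Phi> \<zeta>\<^sub>1) + 2 * Re (M \<zeta>\<^sub>1) < Re (\<Phi> \<zeta>\<^sub>2) + 2 * Re (M \<zeta>\<^sub>2)"
    if "\<zeta>\<^sub>1 \<in> S" "\<zeta>\<^sub>2 \<in> S" "Im (\<Phi> \<zeta>\<^sub>1) = Im (\<Phi> \<zeta>\<^sub>2)" "Re (\<Phi> \<zeta>\<^sub>1) < Re (\<Phi> \<zeta>\<^sub>2)" for \<zeta>\<^sub>1 \<zeta>\<^sub>2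
  proof -
    define c where "c = Im (\<Phi> \<zeta>\<^sub>1)"
    define r where "r u = u + 2 * Re (M (G (of_real u + \<i> * of_real c)))" for u
    have "r (Re (\<Phi> \<zeta>\<^sub>1)) < r (Re (\<Phi> \<zeta>\<^sub>2))"
    proof (rule DERIV_pos_imp_increasing[where f = r])
      \<comment> \<open>The whole horizontal segment lies in the image of \<Phi>, so
        \<open>G\<close> really is the inverse, and is differentiable, at every point where
        \<open>r\<close> evaluates it.\<close>
      fix u assume "Re (\<Phi> \<zeta>\<^sub>1) \<le> u" "u \<le> Re (\<Phi> \<zeta>\<^sub>2)"
      then have "\<exists>\<zeta>. Re \<zeta> < 0 \<and> \<Phi> \<zeta> = Complex u c"
        using that unfolding S_def c_def
        by (intro image_halfplane_horizontally_convex[OF der pos per]) auto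
      then obtain \<zeta> where \<zeta>: "Re \<zeta> < 0" "\<Phi> \<zeta> = Complex u c"
        by blast
      then have eq: "of_real u + \<i> * of_real c = \<Phi> \<zeta>" and "\<zeta> \<in> S"
        by (simp_all add: Complex_eq S_def)
      have "((\<lambda>z. M (G z)) has_field_derivative M' \<zeta> * inverse (\<Phi>' \<zeta>)) (at (\<Phi> \<zeta>))"
        using DERIV_chain2[of M "M' \<zeta>" G "\<Phi> \<zeta>"] derM[OF \<zeta>(1)] derG[OF \<open>\<zeta> \<in> S\<close>] G(3)[OF \<open>\<zeta> \<in> S\<close>]
        by simp
      moreover have "((\<lambda>u. of_real u + \<i> * of_real c) has_vector_derivative 1) (at u)"
        by (auto intro!: derivative_eq_intros)
      ultimately have "((\<lambda>u. M (G (of_real u + \<i> * of_real c))) has_vector_derivative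
          M' \<zeta> * inverse (\<Phi>' \<zeta>)) (at u)"
        using field_vector_diff_chain_at[of "\<lambda>u. of_real u + \<i> * of_real c" 1 u "\<lambda>z. M (G z)"] eq
        by (simp add: o_def)
      then have "((\<lambda>u. Re (M (G (of_real u + \<i> * of_real c)))) has_vector_derivative
          Re (M' \<zeta> * inverse (\<Phi>' \<zeta>))) (at u)"
        by (rule bounded_linear.has_vector_derivative[OF bounded_linear_Re])
      then have "((\<lambda>u. Re (M (G (of_real u + \<i> * of_real c)))) has_real_derivative
          Re (M' \<zeta> * inverse (\<Phi>' \<zeta>))) (at u)"
        by (simp add: has_real_derivative_iff_has_vector_derivative)
      from DERIV_add[OF DERIV_ident DERIV_cmult[OF this, of 2]]
      have "(r has_real_derivative 1 + 2 * Re (M' \<zeta> / \<Phi>' \<zeta>)) (at u)"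
        unfolding r_def divide_inverse .
      then show "\<exists>y. (r has_real_derivative y) (at u) \<and> y > 0"
        using posM[OF \<zeta>(1)] by blast
    qed (fact that)
    moreover have "r (Re (\<Phi> \<zeta>)) = Re (\<Phi> \<zeta>) + 2 * Re (M \<zeta>)" if "\<zeta> \<in> S" "Im (\<Phi> \<zeta>) = c" for \<zeta>
    proof -
      have "of_real (Re (\<Phi> \<zeta>)) + \<i> * of_real c = \<Phi> \<zeta>"
        using that by (simp add: complex_eq_iff)
      then show ?thesis
        using G(3)[OF that(1)] by (simp add: r_def)
    qed
    ultimately show ?thesis
      using that by (simp add: c_def)
  qed
  show ?thesis
    unfolding S_def[symmetric]
  proof (rule inj_onI)
    fix a b assume ab: "a \<in> S" "b \<in> S"
      and eq: "\<Phi> a + of_real (2 * Re (M a)) = \<Phi> b + of_real (2 * Re (M b))"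
    have Im: "Im (\<Phi> a) = Im (\<Phi> b)"
      using arg_cong[OF eq, of Im] by simp
    have "Re (\<Phi> a) = Re (\<Phi> b)"
      using less[OF ab Im] less[OF ab(2,1) Im[symmetric]] arg_cong[OF eq, of Re]
      by (cases "Re (\<Phi> a)" "Re (\<Phi> b)" rule: linorder_cases) auto
    with Im have "\<Phi> a = \<Phi> b"
      by (simp add: complex_eq_iff)
    then show "a = b"
      using inj ab by (auto dest: inj_onD)
  qed
qed

section \<open>Univalence on the disk through the exponential covering\<close>

lemma exp_in_unit_disk_iff: "exp \<zeta> \<in> unit_disk \<longleftrightarrow> Re \<zeta> < 0"
  by (simp add: unit_disk_def)

text \<open>The left side is the real part of the Moebius transform
  \<open>(1 + a) / (1 - a)\<close>, which carries the unit disk to the right half-plane.\<close>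

lemma Re_one_plus_twice_div_pos:
  assumes "norm (a :: complex) < 1"
  shows "1 + 2 * Re (a / (1 - a)) > 0"
proof -
  have "a \<noteq> 1"
    using assms by auto
  then have *: "1 + 2 * (a / (1 - a)) = (1 + a) / (1 - a)"
    by (simp add: field_simps)
  have "1 + 2 * Re (a / (1 - a)) = Re ((1 + a) / (1 - a))"
    unfolding *[symmetric] by (simp del: times_divide_eq_right)
  also have "\<dots> = (1 - (norm a)\<^sup>2) / (norm (1 - a))\<^sup>2"
    by (simp add: Re_divide cmod_power2) (simp add: algebra_simps power2_eq_square)
  also have "\<dots> > 0"
    using assms \<open>a \<noteq> 1\<close> by (simp add: power_less_one_iff abs_square_less_1)
  finally show ?thesis .
qed

text \<open>The exponential covers the punctured disk by the left half-plane, and \<open>F\<close>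
  lifts to \<Psi> there. The lift is injective and commutes with translation by the periods of
  \<open>exp\<close>, so injectivity descends to \<open>F\<close>.\<close>

lemma inj_on_logharmonic:
  assumes dA: "\<And>z. z \<in> unit_disk \<Longrightarrow> (A has_field_derivative A' z) (at z)"
    and dB: "\<And>z. z \<in> unit_disk \<Longrightarrow> (B has_field_derivative B' z) (at z)"
    and F: "\<forall>z\<in>unit_disk. F z = z * exp (A z) * cnj (exp (B z))"
    and a: "a \<in> dilatations"
    and eq: "\<And>z. z \<in> unit_disk \<Longrightarrow> z * B' z = a z * (1 + z * A' z)"
    and pos: "\<And>z. z \<in> unit_disk \<Longrightarrow> Re (1 + z * A' z - z * B' z) > 0"
  shows "inj_on F unit_disk"
proof -
  define \<Phi> where "\<Phi> \<zeta> = \<zeta> + A (exp \<zeta>) - B (exp \<zeta>)" for \<zeta>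
  define \<Phi>' where "\<Phi>' \<zeta> = 1 + exp \<zeta> * A' (exp \<zeta>) - exp \<zeta> * B' (exp \<zeta>)" for \<zeta>
  define \<Psi> where "\<Psi> \<zeta> = \<Phi> \<zeta> + of_real (2 * Re (B (exp \<zeta>)))" for \<zeta>
  have per: "exp (\<zeta> + of_int n * (2 * pi * \<i>)) = exp \<zeta>" for \<zeta> n
    using exp_plus_2pin[of \<zeta> n] by (simp add: mult_ac)
  have F_exp: "F (exp \<zeta>) = exp (\<Psi> \<zeta>)" if "Re \<zeta> < 0" for \<zeta>
  proof -
    have "of_real (2 * Re (B (exp \<zeta>))) = B (exp \<zeta>) + cnj (B (exp \<zeta>))"
      by (simp only: complex_add_cnj)
    then have "\<Psi> \<zeta> = \<zeta> + A (exp \<zeta>) + cnj (B (exp \<zeta>))"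
      by (simp add: \<Psi>_def \<Phi>_def)
    then show ?thesis
      using F that by (simp add: exp_in_unit_disk_iff exp_add exp_cnj)
  qed
  have "inj_on \<Psi> {\<zeta>. Re \<zeta> < 0}"
    unfolding \<Psi>_def
  proof (rule inj_on_halfplane_plus_Re[where \<Phi>' = \<Phi>' and M' = "\<lambda>\<zeta>. exp \<zeta> * B' (exp \<zeta>)"])
    fix \<zeta> :: complex assume \<zeta>: "Re \<zeta> < 0"
    let ?z = "exp \<zeta>"
    have z: "?z \<in> unit_disk"
      using \<zeta> by (simp add: exp_in_unit_disk_iff)
    note [derivative_intros] = DERIV_chain2[OF dA] DERIV_chain2[OF dB]
    show "(\<Phi> has_field_derivative \<Phi>' \<zeta>) (at \<zeta>)"
      unfolding \<Phi>_def \<Phi>'_def using z by (auto intro!: derivative_eq_intros)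
    show "((\<lambda>\<zeta>. B (exp \<zeta>)) has_field_derivative ?z * B' ?z) (at \<zeta>)"
      using z by (auto intro!: derivative_eq_intros)
    show Re: "Re (\<Phi>' \<zeta>) > 0"
      using pos[OF z] by (simp add: \<Phi>'_def)
    show "\<Phi> (\<zeta> + of_int n * (2 * pi * \<i>)) = \<Phi> \<zeta> + of_int n * (2 * pi * \<i>)" for n
      unfolding \<Phi>_def per by simp
    \<comment> \<open>By \<open>eq\<close>, the derivative of \<Phi> factors, and \<open>A'\<close>
      cancels from the quotient below. What remains depends on \<open>a\<close> alone.\<close>
    have \<Phi>': "\<Phi>' \<zeta> = (1 + ?z * A' ?z) * (1 - a ?z)"
      using eq[OF z] by (simp add: \<Phi>'_def algebra_simps)
    moreover have "\<Phi>' \<zeta> \<noteq> 0"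
      using Re by (metis less_irrefl zero_complex.sel(1))
    ultimately have "1 + ?z * A' ?z \<noteq> 0"
      by auto
    then have "?z * B' ?z / \<Phi>' \<zeta> = a ?z / (1 - a ?z)"
      unfolding \<Phi>' eq[OF z] by simp
    then show "1 + 2 * Re (?z * B' ?z / \<Phi>' \<zeta>) > 0"
      using a z Re_one_plus_twice_div_pos by (simp add: dilatations_def)
  qed
  then have inj: "\<zeta>\<^sub>1 = \<zeta>\<^sub>2" if "\<Psi> \<zeta>\<^sub>1 = \<Psi> \<zeta>\<^sub>2" "Re \<zeta>\<^sub>1 < 0" "Re \<zeta>\<^sub>2 < 0" for \<zeta>\<^sub>1 \<zeta>\<^sub>2
    using that by (auto dest: inj_onD)
  show ?thesis
  proof (rule inj_onI)
    fix z w assume zw: "z \<in> unit_disk" "w \<in> unit_disk" "F z = F w"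
    show "z = w"
    \<comment> \<open>The origin has no logarithm; it is separated from the other points because
      \<open>F\<close> vanishes only there.\<close>
    proof (cases "z = 0 \<or> w = 0")
      case True
      then show ?thesis
        using zw bspec[OF F zw(1)] bspec[OF F zw(2)] by auto
    next
      case False
      then obtain \<zeta>\<^sub>1 \<zeta>\<^sub>2 where \<zeta>: "z = exp \<zeta>\<^sub>1" "w = exp \<zeta>\<^sub>2"
        by (metis exp_Ln)
      with zw have neg: "Re \<zeta>\<^sub>1 < 0" "Re \<zeta>\<^sub>2 < 0"
        by (simp_all add: exp_in_unit_disk_iff)
      have "exp (\<Psi> \<zeta>\<^sub>1) = exp (\<Psi> \<zeta>\<^sub>2)"
        using zw(3) neg by (simp add: \<zeta> F_exp)
      then obtain n :: int where "\<Psi> \<zeta>\<^sub>1 = \<Psi> \<zeta>\<^sub>2 + of_int (2 * n) * pi * \<i>"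
        using exp_eq by auto
      \<comment> \<open>The period left over from equal exponentials is moved into the argument of
        \<Psi>, where passing back through \<open>exp\<close> removes it.\<close>
      also have "\<dots> = \<Psi> (\<zeta>\<^sub>2 + of_int n * (2 * pi * \<i>))"
        unfolding \<Psi>_def \<Phi>_def per by simp
      finally have "\<zeta>\<^sub>1 = \<zeta>\<^sub>2 + of_int n * (2 * pi * \<i>)"
        by (rule inj) (use neg in auto)
      then show ?thesis
        unfolding \<zeta> by (simp only: per)
    qed
  qed
qed

section \<open>Wirtinger calculus for products \<open>z * exp A * cnj (exp B)\<close>\<close>

text \<open>The coefficients of a real-linear map \<open>p * v + q * cnj v\<close> are recovered
  from its values at 1 and \<i>, which is what the two Wirtinger formulas compute.\<close>

lemma wirtinger_of_has_derivative:
  assumes "(f has_derivative (\<lambda>v. p * v + q * cnj v)) (at z)"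
  shows "wirtinger_z f z = p" "wirtinger_zbar f z = q"
  unfolding wirtinger_z_def wirtinger_zbar_def frechet_derivative_at[OF assms, symmetric]
  by (simp_all add: algebra_simps)

lemma has_derivative_exp_product:
  assumes A: "(A has_field_derivative A') (at z)" and B: "(B has_field_derivative B') (at z)"
    and F: "\<forall>z\<in>unit_disk. F z = z * exp (A z) * cnj (exp (B z))" and z: "z \<in> unit_disk"
  shows "(F has_derivative (\<lambda>v. (1 + z * A') * exp (A z) * cnj (exp (B z)) * v
           + F z * cnj B' * cnj v)) (at z)"
proof -
  have "((\<lambda>z. z * exp (A z) * cnj (exp (B z))) has_derivative
      (\<lambda>v. (1 + z * A') * exp (A z) * cnj (exp (B z)) * v + F z * cnj B' * cnj v)) (at z)"
    using A B unfolding bspec[OF F z] has_field_derivative_def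
    by (auto intro!: derivative_eq_intros simp: algebra_simps)
  then show ?thesis
    by (rule has_derivative_transform_within_open[OF _ open_unit_disk z]) (simp add: F)
qed

lemma wirtinger_log_derivatives:
  assumes A: "(A has_field_derivative A') (at z)" and B: "(B has_field_derivative B') (at z)"
    and F: "\<forall>z\<in>unit_disk. F z = z * exp (A z) * cnj (exp (B z))"
    and z: "z \<in> unit_disk" "z \<noteq> 0"
  shows "F z \<noteq> 0" "z * wirtinger_z F z / F z = 1 + z * A'" "wirtinger_zbar F z / F z = cnj B'"
proof -
  show "F z \<noteq> 0"
    using z by (simp add: F)
  then show "z * wirtinger_z F z / F z = 1 + z * A'" "wirtinger_zbar F z / F z = cnj B'"
    using z by (simp_all add: wirtinger_of_has_derivative[OF has_derivative_exp_product[OF A B F z(1)]] F)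
qed

text \<open>Turns the logharmonic equation into a relation between holomorphic functions:
  conjugating the logarithmic derivative in \<open>cnj z\<close> yields \<open>B'\<close>, and off
  the origin multiplication by \<open>z\<close> is reversible.\<close>

lemma logharmonic_equation_iff:
  assumes A: "(A has_field_derivative A') (at z)" and B: "(B has_field_derivative B') (at z)"
    and F: "\<forall>z\<in>unit_disk. F z = z * exp (A z) * cnj (exp (B z))"
    and z: "z \<in> unit_disk" "z \<noteq> 0"
  shows "cnj (wirtinger_zbar F z) / cnj (F z) = a z * (wirtinger_z F z / F z) \<longleftrightarrow>
         z * B' = a z * (1 + z * A')"
proof -
  have *: "wirtinger_z F z / F z = (1 + z * A') / z"
    using wirtinger_log_derivatives(2)[OF A B F z] z(2) by (simp add: field_simps)
  have "cnj (wirtinger_zbar F z) / cnj (F z) = cnj (wirtinger_zbar F z / F z)"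
    by simp
  also have "\<dots> = B'"
    by (simp only: wirtinger_log_derivatives(3)[OF A B F z] complex_cnj_cnj)
  finally show ?thesis
    using z(2) unfolding * by (auto simp: field_simps)
qed

text \<open>The second term of the quotient is the conjugate of \<open>z * B'\<close>, and
  conjugation does not change the real part. The right side is again the real part of a holomorphic
  function.\<close>

lemma Re_starlike_quotient:
  assumes A: "(A has_field_derivative A') (at z)" and B: "(B has_field_derivative B') (at z)"
    and F: "\<forall>z\<in>unit_disk. F z = z * exp (A z) * cnj (exp (B z))"
    and z: "z \<in> unit_disk" "z \<noteq> 0"
  shows "Re ((z * wirtinger_z F z - cnj z * wirtinger_zbar F z) / F z) = Re (1 + z * A' - z * B')"
proof -
  have "(z * wirtinger_z F z - cnj z * wirtinger_zbar F z) / F z =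
      z * wirtinger_z F z / F z - cnj z * (wirtinger_zbar F z / F z)"
    by (simp add: diff_divide_distrib)
  also have "\<dots> = 1 + z * A' - cnj (z * B')"
    by (simp only: wirtinger_log_derivatives(2,3)[OF A B F z] complex_cnj_mult)
  finally show ?thesis
    by simp
qed

section \<open>The logarithmic derivative of \<open>lh_k\<close>\<close>

text \<open>Since \<open>a 0 = 0\<close>, the integrand extends holomorphically over the origin, and
  \<open>lh_k a\<close> is the exponential of a primitive of the extension. Every analytic logarithm
  has the same derivative, so the choice of \<open>L\<close> does not matter.\<close>

lemma lh_k_log_derivative:
  assumes a: "a \<in> dilatations" "a 0 = 0"
    and L: "L holomorphic_on unit_disk" "\<And>z. z \<in> unit_disk \<Longrightarrow> exp (L z) = lh_k a z"
    and z: "z \<in> unit_disk"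
  shows "z * deriv L z = a z / (1 - a z)"
proof -
  \<comment> \<open>\<open>c\<close> is \<open>a z / z\<close> with the removable singularity filled
    by \<open>deriv a 0\<close>; thus \<open>b\<close> is the holomorphic extension of the
    integrand.\<close>
  define c where "c = (\<lambda>z. if z = 0 then deriv a 0 else (a z - a 0) / (z - 0))"
  define b where "b z = c z / (1 - a z)" for z
  have hol_a: "a holomorphic_on unit_disk" and ne: "1 - a z \<noteq> 0" if "z \<in> unit_disk" for z
    using a that by (force simp: dilatations_def)+
  have "c holomorphic_on unit_disk"
    unfolding c_def using hol_a[OF zero_in_unit_disk]
    by (intro pole_lemma) (simp_all add: interior_open open_unit_disk zero_in_unit_disk)
  then have "b holomorphic_on unit_disk"
    unfolding b_def using ne hol_a[OF zero_in_unit_disk] by (intro holomorphic_intros) auto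
  then obtain P where P: "\<And>z. z \<in> unit_disk \<Longrightarrow> (P has_field_derivative b z) (at z within unit_disk)"
    using holomorphic_convex_primitive'[OF convex_unit_disk open_unit_disk] by metis
  have b_eq: "b s = a s / (1 - a s) * (1 / s)" if "s \<noteq> 0" for s
    using that a by (simp add: b_def c_def)
  have int: "lh_integral a w = P w - P 0" if w: "w \<in> unit_disk" for w
  proof (cases "w = 0")
    case True
    then show ?thesis
      by (simp add: lh_integral_def)
  next
    case False
    have "closed_segment 0 w \<subseteq> unit_disk"
      using w zero_in_unit_disk convex_unit_disk by (simp add: closed_segment_subset)
    then have "contour_integral (linepath 0 w) b = P w - P 0"
      using contour_integral_primitive[of unit_disk P b "linepath 0 w"] P
      by (auto intro: contour_integral_unique)
    \<comment> \<open>The two integrands differ at most at the starting point 0, where division by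
      zero gives the original one the value 0.\<close>
    moreover have "lh_integral a w = contour_integral (linepath 0 w) b"
      unfolding lh_integral_def using False b_eq
      by (intro contour_integral_spike_finite_simple_path[of "{0}"]) (auto simp: simple_path_linepath)
    ultimately show ?thesis
      by simp
  qed
  have dL: "(L has_field_derivative deriv L z) (at z)"
    using L(1) open_unit_disk z by (rule holomorphic_derivI)
  \<comment> \<open>The same function is differentiated twice, once through \<open>L\<close> and
    once through \<open>P\<close>; cancelling the nonzero exponential compares the derivatives
    without comparing the logarithms.\<close>
  have "((\<lambda>w. exp (L w)) has_field_derivative exp (L z) * deriv L z) (at z)"
    by (rule DERIV_chain2[OF DERIV_exp dL])
  moreover have "((\<lambda>w. exp (L w)) has_field_derivative exp (L z) * b z) (at z)"
  proof -
    have "(P has_field_derivative b z) (at z)"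
      using P[OF z] by (simp only: at_within_open[OF z open_unit_disk])
    from DERIV_chain2[OF DERIV_exp DERIV_diff[OF this DERIV_const]]
    have "((\<lambda>w. exp (P w - P 0)) has_field_derivative exp (P z - P 0) * b z) (at z)"
      by simp
    moreover have eq: "exp (P w - P 0) = exp (L w)" if "w \<in> unit_disk" for w
      using that L(2) int by (simp add: lh_k_def)
    ultimately show ?thesis
      unfolding eq[OF z] by (rule has_field_derivative_transform_within_open[OF _ open_unit_disk z])
  qed
  ultimately have "deriv L z = b z"
    by (auto dest: DERIV_unique)
  then show ?thesis
    using a by (cases "z = 0") (simp_all add: b_eq)
qed

section \<open>Starlikeness of the combined mapping\<close>

theorem proposition1:
  fixes \<alpha> :: real and f h g a F :: "complex \<Rightarrow> complex"
  assumes "0 \<le> \<alpha>" and "\<alpha> < 1"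
    and "f \<in> ST_Lh \<alpha>"
    and "logharmonic_factors f h g"
    and "a \<in> dilatations" and "logharmonic_wrt a f"
    and "lh_power_product \<alpha> a h g F"
  shows "F \<in> ST_Lh 0"
proof -
  define c where "c = 1 / (1 - \<alpha>)"
  define d where "d = - \<alpha> / (1 - \<alpha>)"
  \<comment> \<open>The weights sum to 1, which leaves one factor \<open>z\<close> and preserves
    relations affine in the logarithmic derivatives. The last identity shifts the order from
    \<alpha> to 0.\<close>
  have c: "c > 0" "c + d = 1" "c * \<alpha> + d = 0"
    using assms(2) by (auto simp: c_def d_def field_simps)
  obtain hp gp kp where branches: "power_branch c h hp" "power_branch c g gp" "power_branch d (lh_k a) kp"
    and at0: "gp 0 = 1" "kp 0 = 1"
    and F: "\<And>z. z \<in> unit_disk \<Longrightarrow> F z = z * (hp z * kp z) * cnj (gp z * kp z)"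
    using assms(7) unfolding lh_power_product_def c_def d_def by blast
  obtain Lh where Lh: "Lh holomorphic_on unit_disk" "\<And>z. z \<in> unit_disk \<Longrightarrow> exp (Lh z) = h z"
    and hp: "\<And>z. z \<in> unit_disk \<Longrightarrow> hp z = exp (of_real c * Lh z)"
    using branches(1) unfolding power_branch_def by blast
  obtain Lg where Lg: "Lg holomorphic_on unit_disk" "\<And>z. z \<in> unit_disk \<Longrightarrow> exp (Lg z) = g z"
    and gp: "\<And>z. z \<in> unit_disk \<Longrightarrow> gp z = exp (of_real c * Lg z)"
    using branches(2) unfolding power_branch_def by blast
  obtain Lk where Lk: "Lk holomorphic_on unit_disk" "\<And>z. z \<in> unit_disk \<Longrightarrow> exp (Lk z) = lh_k a z"
    and kp: "\<And>z. z \<in> unit_disk \<Longrightarrow> kp z = exp (of_real d * Lk z)"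
    using branches(3) unfolding power_branch_def by blast
  note der = holomorphic_derivI[OF _ open_unit_disk]
  have f: "\<forall>z\<in>unit_disk. f z = z * exp (Lh z) * cnj (exp (Lg z))"
    using assms(4) Lh(2) Lg(2) by (simp add: logharmonic_factors_def)
  have f_eq: "z * deriv Lg z = a z * (1 + z * deriv Lh z)" if z: "z \<in> unit_disk" "z \<noteq> 0" for z
    using logharmonic_equation_iff[OF der[OF Lh(1) z(1)] der[OF Lg(1) z(1)] f z, of a] assms(6) z
      wirtinger_log_derivatives(1)[OF der[OF Lh(1) z(1)] der[OF Lg(1) z(1)] f z]
    by (simp add: logharmonic_wrt_def)
  have f_pos: "Re (1 + z * deriv Lh z - z * deriv Lg z) > \<alpha>" if z: "z \<in> unit_disk" for z
  \<comment> \<open>The starlikeness condition says nothing at the origin, but there the holomorphic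
    expression equals 1.\<close>
  proof (cases "z = 0")
    case False
    have "\<alpha> < Re ((z * wirtinger_z f z - cnj z * wirtinger_zbar f z) / f z)"
      using assms(3) z False by (simp add: ST_Lh_def)
    then show ?thesis
      by (simp only: Re_starlike_quotient[OF der[OF Lh(1) z] der[OF Lg(1) z] f z False])
  qed (use assms(2) in simp)

  \<comment> \<open>The relation \<open>f_eq\<close> extends to the origin by continuity, where it
    reads \<open>0 = a 0\<close>.\<close>
  have a0: "a 0 = 0"
  proof -
    define E where "E z = z * deriv Lg z - a z * (1 + z * deriv Lh z)" for z
    have "a holomorphic_on unit_disk"
      using assms(5) by (simp add: dilatations_def)
    then have "E holomorphic_on unit_disk"
      unfolding E_def using Lg(1) Lh(1) open_unit_disk by (intro holomorphic_intros) auto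
    then have "isCont E 0"
      using open_unit_disk zero_in_unit_disk
      by (meson continuous_on_eq_continuous_at holomorphic_on_imp_continuous_on)
    then have "(E \<longlongrightarrow> E 0) (at 0)"
      by (simp add: isCont_def)
    moreover have "eventually (\<lambda>z. E z = 0) (at 0)"
      unfolding eventually_at_topological using open_unit_disk zero_in_unit_disk f_eq
      by (intro exI[of _ unit_disk]) (auto simp: E_def)
    then have "(E \<longlongrightarrow> 0) (at 0)"
      by (rule tendsto_eventually)
    ultimately have "E 0 = 0"
      by (rule LIM_unique)
    then show ?thesis
      by (simp add: E_def)
  qed

  \<comment> \<open>\<open>A\<close> and \<open>B\<close> are logarithms of the two factors of
    \<open>F\<close>. The same \<open>Lk\<close> enters both, because \<open>lh_K a\<close> is
    \<open>z\<close> times \<open>lh_k a\<close> times its conjugate.\<close>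
  define A where "A z = of_real c * Lh z + of_real d * Lk z" for z
  define B where "B z = of_real c * Lg z + of_real d * Lk z" for z
  define A' where "A' z = of_real c * deriv Lh z + of_real d * deriv Lk z" for z
  define B' where "B' z = of_real c * deriv Lg z + of_real d * deriv Lk z" for z
  have dA: "(A has_field_derivative A' z) (at z)" if "z \<in> unit_disk" for z
    unfolding A_def A'_def using der[OF Lh(1) that] der[OF Lk(1) that]
    by (auto intro!: derivative_eq_intros)
  have dB: "(B has_field_derivative B' z) (at z)" if "z \<in> unit_disk" for z
    unfolding B_def B'_def using der[OF Lg(1) that] der[OF Lk(1) that]
    by (auto intro!: derivative_eq_intros)
  have exp_A: "exp (A z) = hp z * kp z" and exp_B: "exp (B z) = gp z * kp z" if "z \<in> unit_disk" for z
    using that by (simp_all add: A_def B_def exp_add hp gp kp)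
  have F_exp: "\<forall>z\<in>unit_disk. F z = z * exp (A z) * cnj (exp (B z))"
    by (simp add: F exp_A exp_B)
  have F_eq: "z * B' z = a z * (1 + z * A' z)" if z: "z \<in> unit_disk" for z
  proof -
    have k: "z * deriv Lk z = a z / (1 - a z)"
      using lh_k_log_derivative[OF assms(5) a0 Lk z] .
    have "1 - a z \<noteq> 0"
      using assms(5) z by (force simp: dilatations_def)
    \<comment> \<open>So \<open>lh_K a\<close> satisfies the equation of \<open>f\<close>, with
      \<open>Lk\<close> in both roles. The equation is affine in the logarithmic derivatives and
      hence survives the combination with weights \<open>c\<close> and \<open>d\<close>.\<close>
    then have k': "z * deriv Lk z = a z * (1 + z * deriv Lk z)"
      unfolding k by (simp add: field_simps)
    have g: "z * deriv Lg z = a z * (1 + z * deriv Lh z)"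
      using f_eq[OF z] a0 by (cases "z = 0") auto
    have "z * B' z = of_real c * (z * deriv Lg z) + of_real d * (z * deriv Lk z)"
      by (simp add: B'_def algebra_simps)
    also have "\<dots> = of_real c * (a z * (1 + z * deriv Lh z)) + of_real d * (a z * (1 + z * deriv Lk z))"
      using g k' by simp
    also have "\<dots> = a z * (of_real (c + d) + z * A' z)"
      by (simp add: A'_def algebra_simps)
    finally show ?thesis
      by (simp add: c)
  qed
  have F_pos: "Re (1 + z * A' z - z * B' z) > 0" if z: "z \<in> unit_disk" for z
  proof -
    \<comment> \<open>In the difference \<open>Lk\<close> cancels, so the power of
      \<open>lh_K a\<close> contributes only its weight \<open>d\<close>.\<close>
    have "1 + z * A' z - z * B' z = of_real (c + d) + z * A' z - z * B' z"
      by (simp add: c)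
    also have "\<dots> = of_real c * (1 + z * deriv Lh z - z * deriv Lg z) + of_real d"
      by (simp add: A'_def B'_def algebra_simps)
    finally have "Re (1 + z * A' z - z * B' z) = c * Re (1 + z * deriv Lh z - z * deriv Lg z) + d"
      by simp
    also have "\<dots> > c * \<alpha> + d"
      using f_pos[OF z] c(1) by simp
    finally show ?thesis
      by (simp add: c)
  qed
  have "inj_on F unit_disk"
    using dA dB F_exp assms(5) F_eq F_pos by (rule inj_on_logharmonic)
  moreover have "logharmonic_wrt a F"
    unfolding logharmonic_wrt_def
  proof (intro conjI ballI impI)
    show "F differentiable_on unit_disk"
      unfolding differentiable_on_def
      using has_derivative_exp_product[OF dA dB F_exp]
      by (blast intro: differentiable_at_withinI differentiableI)
  next
    fix z assume z: "z \<in> unit_disk" and "F z \<noteq> 0"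
    then have "z \<noteq> 0"
      using F by auto
    then show "cnj (wirtinger_zbar F z) / cnj (F z) = a z * (wirtinger_z F z / F z)"
      using logharmonic_equation_iff[OF dA[OF z] dB[OF z] F_exp z] F_eq[OF z] by simp
  qed
  moreover have "logharmonic_factors F (\<lambda>z. exp (A z)) (\<lambda>z. exp (B z))"
  proof -
    have "A holomorphic_on unit_disk" "B holomorphic_on unit_disk"
      unfolding A_def B_def using Lh(1) Lg(1) Lk(1) by (auto intro!: holomorphic_intros)
    then show ?thesis
      unfolding logharmonic_factors_def using F_exp exp_B[OF zero_in_unit_disk] at0
      by (auto intro!: holomorphic_intros)
  qed
  moreover have "Re ((z * wirtinger_z F z - cnj z * wirtinger_zbar F z) / F z) > 0"
    if z: "z \<in> unit_disk" "z \<noteq> 0" for z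
    using Re_starlike_quotient[OF dA[OF z(1)] dB[OF z(1)] F_exp z] F_pos[OF z(1)] by simp
  ultimately show ?thesis
    unfolding ST_Lh_def using assms(5) by blast
qed

end
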